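(* Let $f:\mathbb{R}^n\to\mathbb{R}\cup\{\infty\}$ be a proper, lower semicontinuous, convex function with $\mathrm{dom}\,f$ unbounded. Then $$N(\infty;\mathrm{dom}\,f)\subset\partial^\infty f(\infty)\subset(\mathrm{dom}\,f^\infty)^\circ.$$ Moreover, the first inclusion is an equality provided the following condition is satisfied: for all $w\in T(\infty;\mathrm{dom}\,f)$ there exists $r\in\mathbb{R}$ such that $(w,r)\in T(\infty_I;\mathrm{epi}\,f)$.
   Context: $\mathrm{dom}\,f=\{x\mid f(x)<\infty\}$; $f$ is proper if $\mathrm{dom}\,f\ne\emptyset$; $\mathrm{epi}\,f=\{(x,r)\in\mathbb{R}^n\times\mathbb{R}\mid r\ge f(x)\}$. For a cone $C$, $C^\circ=\{v\mid\langle v,x\rangle\le0\ \forall x\in C\}$. The recession function is $f^\infty(d)=\lim_{t\to\infty}\frac{f(x_0+td)-f(x_0)}{t}\in\mathbb{R}\cup\{\infty\}$, for any $x_0\in\mathrm{dom}\,f$ (independent of $x_0$); $\mathrm{dom}\,f^\infty=\{d\mid f^\infty(d)<\infty\}$. For a nonempty convex $\Omega\subset\mathbb{R}^n$: $T(\infty;\Omega)$ is the set of $w$ such that for all sequences $x_k\in\Omega$ with $\|x_k\|\to\infty$ and all $t_k>0$ with $t_k\to0$ there exist $w_k\to w$ with $x_k+t_kw_k\in\Omega$ for all $k$; $N(\infty;\Omega)=\{v\mid\langle v,w\rangle\le0\ \forall w\in T(\infty;\Omega)\}$. With $I=\{1,\dots,n\}$ selecting the $x$-coordinates in $\mathbb{R}^n\times\mathbb{R}$: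 $T(\infty_I;\mathrm{epi}\,f)$ is the set of $(w,\rho)$ such that for all sequences $(x_k,r_k)\in\mathrm{epi}\,f$ with $\|x_k\|\to\infty$ and all $t_k>0$ with $t_k\to0$ there exist $(w_k,\rho_k)\to(w,\rho)$ with $(x_k,r_k)+t_k(w_k,\rho_k)\in\mathrm{epi}\,f$ for all $k$. $N(\infty_I;\mathrm{epi}\,f)=\{(u,c)\mid\langle u,w\rangle+c\rho\le0\ \forall(w,\rho)\in T(\infty_I;\mathrm{epi}\,f)\}$, and $\partial^\infty f(\infty)=\{u\mid(u,0)\in N(\infty_I;\mathrm{epi}\,f)\}$. *)

theory Defs
  imports "HOL-Analysis.Analysis"
begin

text \<open>
  A function with values in the reals extended by plus infinity is a function into \<^typ>\<open>ereal\<close>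
  that never takes the value \<^term>\<open>-\<infinity>::ereal\<close>; the latter condition is stated separately.
\<close>

definition edom :: "('a \<Rightarrow> ereal) \<Rightarrow> 'a set" where
  "edom f = {x. f x < \<infinity>}"

definition proper :: "('a \<Rightarrow> ereal) \<Rightarrow> bool" where
  "proper f \<longleftrightarrow> edom f \<noteq> {}"

definition epi :: "('a \<Rightarrow> ereal) \<Rightarrow> ('a \<times> real) set" where
  "epi f = {(x, r). f x \<le> ereal r}"

definition lower_semicont :: "('a::topological_space \<Rightarrow> ereal) \<Rightarrow> bool" where
  "lower_semicont f \<longleftrightarrow> (\<forall>x. f x \<le> Liminf (at x) f)"

text \<open>The conventions of \<^typ>\<open>ereal\<close> give \<open>0 * \<infinity> = 0\<close>, so the endpoint weights are harmless.\<close>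

definition econvex :: "('a::real_vector \<Rightarrow> ereal) \<Rightarrow> bool" where
  "econvex f \<longleftrightarrow> (\<forall>x y. \<forall>u\<ge>0. \<forall>v\<ge>0. u + v = 1 \<longrightarrow>
     f (u *\<^sub>R x + v *\<^sub>R y) \<le> ereal u * f x + ereal v * f y)"

definition polar :: "'a::real_inner set \<Rightarrow> 'a set" where
  "polar C = {v. \<forall>x\<in>C. v \<bullet> x \<le> 0}"

text \<open>
  The recession function at \<open>d\<close> is the common value of the limits of the difference quotients
  over all base points in the domain; existence and independence of the base point are
  established in \<open>recession_fun_tendsto\<close> below.
\<close>

definition recession_fun :: "('a::real_vector \<Rightarrow> ereal) \<Rightarrow> 'a \<Rightarrow> ereal" where
  "recession_fun f d = (THE l. \<forall>x0\<in>edom f.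
     ((\<lambda>t. (f (x0 + t *\<^sub>R d) - f x0) / ereal t) \<longlongrightarrow> l) at_top)"

definition tangent_inf :: "'a::real_normed_vector set \<Rightarrow> 'a set" where
  "tangent_inf \<Omega> = {w. \<forall>(x :: nat \<Rightarrow> 'a) (t :: nat \<Rightarrow> real).
     (\<forall>k. x k \<in> \<Omega>) \<and> filterlim (\<lambda>k. norm (x k)) at_top sequentially \<and>
     (\<forall>k. t k > 0) \<and> t \<longlonglongrightarrow> 0 \<longrightarrow>
     (\<exists>w'. w' \<longlonglongrightarrow> w \<and> (\<forall>k. x k + t k *\<^sub>R w' k \<in> \<Omega>))}"

definition normal_inf :: "'a::real_inner set \<Rightarrow> 'a set" where
  "normal_inf \<Omega> = {v. \<forall>w\<in>tangent_inf \<Omega>. v \<bullet> w \<le> 0}"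

text \<open>
  The partial versions at infinity, for subsets of a product with the reals: only the first
  component of the base points is required to tend to infinity in norm.
\<close>

definition tangent_inf_fst :: "('a::real_normed_vector \<times> real) set \<Rightarrow> ('a \<times> real) set" where
  "tangent_inf_fst E = {(w, \<rho>). \<forall>(x :: nat \<Rightarrow> 'a) (r :: nat \<Rightarrow> real) (t :: nat \<Rightarrow> real).
     (\<forall>k. (x k, r k) \<in> E) \<and> filterlim (\<lambda>k. norm (x k)) at_top sequentially \<and>
     (\<forall>k. t k > 0) \<and> t \<longlonglongrightarrow> 0 \<longrightarrow>
     (\<exists>w' \<rho>'. (\<lambda>k. (w' k, \<rho>' k)) \<longlonglongrightarrow> (w, \<rho>) \<and>
        (\<forall>k. (x k, r k) + t k *\<^sub>R (w' k, \<rho>' k) \<in> E))}"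

definition normal_inf_fst :: "('a::real_inner \<times> real) set \<Rightarrow> ('a \<times> real) set" where
  "normal_inf_fst E = {(u, c). \<forall>(w, \<rho>)\<in>tangent_inf_fst E. u \<bullet> w + c * \<rho> \<le> 0}"

definition singular_subdiff_inf :: "('a::real_inner \<Rightarrow> ereal) \<Rightarrow> 'a set" where
  "singular_subdiff_inf f = {u. (u, 0) \<in> normal_inf_fst (epi f)}"

lemma recession_fun_tendsto:
  fixes f :: "'a::real_normed_vector \<Rightarrow> ereal"
  assumes ninf: "\<And>x. f x \<noteq> -\<infinity>" and lsc: "lower_semicont f" and conv: "econvex f"
    and x0: "x0 \<in> edom f"
  shows "((\<lambda>t. (f (x0 + t *\<^sub>R d) - f x0) / ereal t) \<longlongrightarrow> recession_fun f d) at_top"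
proof -
  define q where "q = (\<lambda>x t. (f (x + t *\<^sub>R d) - f x) / ereal t)"
  define L where "L = (\<lambda>x. SUP t\<in>{0<..}. q x t)"
  have fin: "f x = ereal (real_of_ereal (f x))" if "x \<in> edom f" for x
    using that ninf[of x] by (cases "f x") (auto simp: edom_def)
  have q_le: "q x t \<le> ereal l \<longleftrightarrow> f (x + t *\<^sub>R d) \<le> ereal (real_of_ereal (f x) + t * l)"
    if x: "x \<in> edom f" and t: "t > 0" for x t l
  proof -
    obtain a where a: "f x = ereal a" using fin[OF x] by blast
    show ?thesis
    proof (cases "f (x + t *\<^sub>R d)")
      case (real b)
      then show ?thesis using a t by (simp add: q_def pos_divide_le_eq algebra_simps)
    qed (use a t ninf in \<open>auto simp: q_def\<close>)
  qed
  have cv: "f (u *\<^sub>R x + v *\<^sub>R y) \<le> ereal (u * a + v * b)"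
    if "f x \<le> ereal a" "f y \<le> ereal b" "u \<ge> 0" "v \<ge> 0" "u + v = 1" for x y a b u v
  proof -
    have "f (u *\<^sub>R x + v *\<^sub>R y) \<le> ereal u * f x + ereal v * f y"
      using conv that unfolding econvex_def by blast
    also have "\<dots> \<le> ereal u * ereal a + ereal v * ereal b"
      using that by (intro add_mono ereal_mult_left_mono) auto
    finally show ?thesis by simp
  qed
  have mono: "q x s \<le> q x t" if x: "x \<in> edom f" and st: "0 < s" "s \<le> t" for x s t
  proof (rule ereal_le_real)
    fix l assume "q x t \<le> ereal l"
    then have *: "f (x + t *\<^sub>R d) \<le> ereal (real_of_ereal (f x) + t * l)"
      using q_le[OF x, of t] st by simp
    have "f ((1 - s/t) *\<^sub>R x + (s/t) *\<^sub>R (x + t *\<^sub>R d))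
        \<le> ereal ((1 - s/t) * real_of_ereal (f x) + (s/t) * (real_of_ereal (f x) + t * l))"
      using st fin[OF x] by (intro cv *) auto
    moreover have "(1 - s/t) *\<^sub>R x + (s/t) *\<^sub>R (x + t *\<^sub>R d) = x + s *\<^sub>R d"
      using st by (simp add: algebra_simps)
    moreover have "(1 - s/t) * real_of_ereal (f x) + (s/t) * (real_of_ereal (f x) + t * l)
        = real_of_ereal (f x) + s * l"
      using st by (simp add: field_simps)
    ultimately show "q x s \<le> ereal l" using q_le[OF x] st by simp
  qed
  have lim: "(q x \<longlongrightarrow> L x) at_top" if x: "x \<in> edom f" for x
  proof (rule increasing_tendsto)
    show "\<forall>\<^sub>F t in at_top. q x t \<le> L x"
      using eventually_gt_at_top[of 0] by eventually_elim (auto simp: L_def intro: SUP_upper)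
  next
    fix c assume "c < L x"
    then obtain s where s: "s > 0" "c < q x s" by (auto simp: L_def less_SUP_iff)
    show "\<forall>\<^sub>F t in at_top. c < q x t"
      using eventually_ge_at_top[of s]
      by eventually_elim (use s mono[OF x s(1)] in \<open>auto intro: less_le_trans\<close>)
  qed
  have le: "L y \<le> L x" if x: "x \<in> edom f" and y: "y \<in> edom f" for x y
  proof (rule ereal_le_real)
    fix l assume l: "L x \<le> ereal l"
    let ?a = "real_of_ereal (f x)" and ?b = "real_of_ereal (f y)"
    have fx: "f (x + s *\<^sub>R d) \<le> ereal (?a + s * l)" if "s > 0" for s
      using q_le[OF x that] l that by (auto simp: L_def SUP_le_iff)
    have "f (y + t *\<^sub>R d) \<le> ereal (?b + t * l)" if t: "t > 0" for t
    proof (rule ccontr)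
      define z where "z = (\<lambda>s. (1 - t/s) *\<^sub>R y + (t/s) *\<^sub>R x + t *\<^sub>R d)"
      assume "\<not> ?thesis"
      then obtain c where c: "ereal (?b + t * l) < ereal c" "ereal c < f (y + t *\<^sub>R d)"
        using ereal_dense2[of "ereal (?b + t * l)" "f (y + t *\<^sub>R d)"] by (auto simp: not_le)
      have t0: "((\<lambda>s. t/s) \<longlongrightarrow> 0) at_top"
        by (intro tendsto_divide_0[OF tendsto_const]
            filterlim_mono[OF filterlim_ident at_top_le_at_infinity order_refl])
      have "(z \<longlongrightarrow> (1 - 0) *\<^sub>R y + 0 *\<^sub>R x + t *\<^sub>R d) at_top"
        unfolding z_def by (intro tendsto_intros t0)
      then have z: "filterlim z (nhds (y + t *\<^sub>R d)) at_top" by simp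
      have "ereal c < Liminf (at (y + t *\<^sub>R d)) f"
        using c(2) lsc unfolding lower_semicont_def by (meson less_le_trans)
      then have "\<forall>\<^sub>F w in at (y + t *\<^sub>R d). ereal c < f w" by (rule less_LiminfD)
      then have "\<forall>\<^sub>F w in nhds (y + t *\<^sub>R d). ereal c < f w"
        using c(2) by (simp add: eventually_nhds_conv_at)
      then have ev1: "\<forall>\<^sub>F s in at_top. ereal c < f (z s)"
        using z by (rule eventually_compose_filterlim)
      have ev2: "\<forall>\<^sub>F s in at_top. f (z s) \<le> ereal ((1 - t/s) * ?b + (t/s) * ?a + t * l)"
        using eventually_ge_at_top[of t]
      proof eventually_elim
        case (elim s)
        then have s: "s > 0" using t by simp
        have "f ((1 - t/s) *\<^sub>R y + (t/s) *\<^sub>R (x + s *\<^sub>R d))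
            \<le> ereal ((1 - t/s) * ?b + (t/s) * (?a + s * l))"
          using s t elim fin[OF y] by (intro cv fx) auto
        moreover have "(1 - t/s) *\<^sub>R y + (t/s) *\<^sub>R (x + s *\<^sub>R d) = z s"
          using s by (simp add: z_def algebra_simps)
        moreover have "(1 - t/s) * ?b + (t/s) * (?a + s * l)
            = (1 - t/s) * ?b + (t/s) * ?a + t * l"
          using s by (simp add: field_simps)
        ultimately show ?case by (simp only:)
      qed
      have "((\<lambda>s. (1 - t/s) * ?b + (t/s) * ?a + t * l) \<longlongrightarrow> (1 - 0) * ?b + 0 * ?a + t * l) at_top"
        by (intro tendsto_intros t0)
      then have "\<forall>\<^sub>F s in at_top. (1 - t/s) * ?b + (t/s) * ?a + t * l < c"
        by (rule order_tendstoD(2)) (use c(1) in simp)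
      with ev1 ev2 have "\<forall>\<^sub>F s::real in at_top. False"
        by eventually_elim (metis ereal_less_eq(3) less_le_trans not_less order_less_imp_le)
      then show False by simp
    qed
    then show "L y \<le> ereal l"
      using q_le[OF y] by (auto simp: L_def SUP_le_iff)
  qed
  have eq: "L x = L x0" if "x \<in> edom f" for x
    using le x0 that by (simp add: order_antisym)
  have "recession_fun f d = L x0"
    unfolding recession_fun_def
  proof (rule the_equality)
    show "\<forall>x\<in>edom f. ((\<lambda>t. (f (x + t *\<^sub>R d) - f x) / ereal t) \<longlongrightarrow> L x0) at_top"
      using lim eq by (auto simp: q_def)
  next
    fix l assume "\<forall>x\<in>edom f. ((\<lambda>t. (f (x + t *\<^sub>R d) - f x) / ereal t) \<longlongrightarrow> l) at_top"
    then have "(q x0 \<longlongrightarrow> l) at_top" using x0 by (simp add: q_def)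
    then show "l = L x0"
      using lim[OF x0] by (intro tendsto_unique[of at_top "q x0"]) auto
  qed
  then show ?thesis using lim[OF x0] by (simp add: q_def)
qed

end

theory Submission
  imports Defs
begin

text \<open>
  All three claims compare tangent cones. Tangent vectors to the epigraph project to tangent
  vectors to the domain, since a point \<open>x\<close> of the domain lifts to \<open>(x, f x)\<close>. Conversely, a
  direction \<open>d\<close> along which \<open>f\<close> has asymptotic slope below \<open>\<rho>\<close> satisfies
  \<open>f (x + t d) \<le> f x + t \<rho>\<close> everywhere by convexity, so \<open>(d, \<rho>)\<close> is tangent to the epigraph,
  with constant approximating sequences.
\<close>

lemma tangent_inf_fst_epi_imp_tangent_inf_edom:
  fixes f :: "'a::real_normed_vector \<Rightarrow> ereal"
  assumes ninf: "\<And>x. f x \<noteq> -\<infinity>"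
    and tan: "(w, \<rho>) \<in> tangent_inf_fst (epi f)"
  shows "w \<in> tangent_inf (edom f)"
  unfolding tangent_inf_def
proof (intro CollectI allI impI, elim conjE)
  fix x :: "nat \<Rightarrow> 'a" and t :: "nat \<Rightarrow> real"
  assume x: "\<forall>k. x k \<in> edom f" "filterlim (\<lambda>k. norm (x k)) at_top sequentially"
    and t: "\<forall>k. t k > 0" "t \<longlonglongrightarrow> 0"
  \<comment> \<open>\<open>real_of_ereal\<close> returns the true value here: \<open>f\<close> is
    below infinity on the domain and never minus infinity.\<close>
  have lift: "\<forall>k. (x k, real_of_ereal (f (x k))) \<in> epi f"
  proof
    fix k
    show "(x k, real_of_ereal (f (x k))) \<in> epi f"
      using x(1)[rule_format, of k] ninf[of "x k"]
      by (cases "f (x k)") (auto simp: edom_def epi_def)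
  qed
  have "\<forall>x r t. (\<forall>k. (x k, r k) \<in> epi f) \<and>
      filterlim (\<lambda>k. norm (x k)) at_top sequentially \<and> (\<forall>k. t k > 0) \<and> t \<longlonglongrightarrow> 0 \<longrightarrow>
      (\<exists>w' \<rho>'. (\<lambda>k. (w' k, \<rho>' k)) \<longlonglongrightarrow> (w, \<rho>) \<and>
        (\<forall>k. (x k, r k) + t k *\<^sub>R (w' k, \<rho>' k) \<in> epi f))"
    using tan unfolding tangent_inf_fst_def by simp
  from this[THEN spec, THEN spec, THEN spec, of x "\<lambda>k. real_of_ereal (f (x k))" t]
  obtain w' \<rho>' where lim: "(\<lambda>k. (w' k, \<rho>' k)) \<longlonglongrightarrow> (w, \<rho>)"
    and mem: "\<And>k. (x k, real_of_ereal (f (x k))) + t k *\<^sub>R (w' k, \<rho>' k) \<in> epi f"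
    using lift x t by blast
  have "w' \<longlonglongrightarrow> w" using tendsto_fst[OF lim] by simp
  \<comment> \<open>Carrying a real height in the epigraph forces the value of \<open>f\<close> to
    be below infinity.\<close>
  moreover have "x k + t k *\<^sub>R w' k \<in> edom f" for k
    using mem[of k] by (auto simp: epi_def edom_def intro: le_less_trans)
  ultimately show "\<exists>w'. w' \<longlonglongrightarrow> w \<and> (\<forall>k. x k + t k *\<^sub>R w' k \<in> edom f)" by blast
qed

text \<open>Real upper bounds at both endpoints keep infinite values out of the later convexity
  arguments.\<close>

lemma econvex_ereal_le:
  assumes "econvex f" "f x \<le> ereal a" "f y \<le> ereal b" "u \<ge> 0" "v \<ge> 0" "u + v = 1"
  shows "f (u *\<^sub>R x + v *\<^sub>R y) \<le> ereal (u * a + v * b)"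
proof -
  have "f (u *\<^sub>R x + v *\<^sub>R y) \<le> ereal u * f x + ereal v * f y"
    using assms unfolding econvex_def by blast
  also have "\<dots> \<le> ereal u * ereal a + ereal v * ereal b"
    using assms by (intro add_mono ereal_mult_left_mono) auto
  finally show ?thesis by simp
qed

text \<open>The strict inequality puts the difference quotient at \<open>x\<close> below
  \<open>\<rho>\<close> for all large steps; convexity carries the bound from one such step back to
  \<open>t\<close>.\<close>

lemma recession_fun_less_imp_le:
  fixes f :: "'a::real_normed_vector \<Rightarrow> ereal"
  assumes ninf: "\<And>x. f x \<noteq> -\<infinity>" and lsc: "lower_semicont f" and conv: "econvex f"
    and slope: "recession_fun f d < ereal \<rho>" and r: "f x \<le> ereal r" and t: "t > 0"
  shows "f (x + t *\<^sub>R d) \<le> ereal (r + t * \<rho>)"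
proof -
  have x: "x \<in> edom f" using r by (auto simp: edom_def intro: le_less_trans)
  then obtain a where a: "f x = ereal a" using ninf[of x] by (cases "f x") (auto simp: edom_def)
  have "\<forall>\<^sub>F s in at_top. (f (x + s *\<^sub>R d) - f x) / ereal s < ereal \<rho>"
    using recession_fun_tendsto[OF ninf lsc conv x] slope by (rule order_tendstoD(2))
  \<comment> \<open>The far step \<open>s\<close> is taken at least \<open>t\<close>, so that
    \<open>x + t d\<close> lies on the segment from \<open>x\<close> to \<open>x + s d\<close>, with
    weight \<open>t/s\<close> at the far end.\<close>
  with eventually_ge_at_top[of t]
  have "\<forall>\<^sub>F s in at_top. t \<le> s \<and> (f (x + s *\<^sub>R d) - f x) / ereal s < ereal \<rho>"
    by eventually_elim simp
  then obtain s where s: "t \<le> s" "(f (x + s *\<^sub>R d) - f x) / ereal s < ereal \<rho>"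
    using eventually_happens'[OF trivial_limit_at_top_linorder] by blast
  \<comment> \<open>The value plus infinity is excluded because it would make the quotient
    infinite.\<close>
  have "f (x + s *\<^sub>R d) \<le> ereal (a + s * \<rho>)"
  proof (cases "f (x + s *\<^sub>R d)")
    case (real b)
    then show ?thesis using s t a by (simp add: pos_divide_less_eq algebra_simps)
  qed (use s t a in auto)
  then have "f ((1 - t/s) *\<^sub>R x + (t/s) *\<^sub>R (x + s *\<^sub>R d))
      \<le> ereal ((1 - t/s) * a + (t/s) * (a + s * \<rho>))"
    using s t a by (intro econvex_ereal_le[OF conv]) auto
  moreover have "(1 - t/s) *\<^sub>R x + (t/s) *\<^sub>R (x + s *\<^sub>R d) = x + t *\<^sub>R d"
    using s t by (simp add: algebra_simps)
  moreover have "(1 - t/s) * a + (t/s) * (a + s * \<rho>) = a + t * \<rho>"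
    using s t by (simp add: field_simps)
  ultimately have "f (x + t *\<^sub>R d) \<le> ereal (a + t * \<rho>)" by simp
  \<comment> \<open>Passing from the value \<open>a\<close> to any \<open>r\<close> above it covers
    epigraph points off the graph.\<close>
  also have "\<dots> \<le> ereal (r + t * \<rho>)" using r a by simp
  finally show ?thesis .
qed

lemma recession_fun_less_imp_tangent_inf_fst_epi:
  fixes f :: "'a::real_normed_vector \<Rightarrow> ereal"
  assumes "\<And>x. f x \<noteq> -\<infinity>" "lower_semicont f" "econvex f" "recession_fun f d < ereal \<rho>"
  shows "(d, \<rho>) \<in> tangent_inf_fst (epi f)"
  unfolding tangent_inf_fst_def
proof (intro CollectI case_prodI allI impI, elim conjE)
  fix x :: "nat \<Rightarrow> 'a" and r t :: "nat \<Rightarrow> real"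
  assume "\<forall>k. (x k, r k) \<in> epi f" "\<forall>k. t k > 0"
  then have "\<forall>k. (x k, r k) + t k *\<^sub>R (d, \<rho>) \<in> epi f"
    using recession_fun_less_imp_le[OF assms] by (simp add: epi_def)
  then show "\<exists>w' \<rho>'. (\<lambda>k. (w' k, \<rho>' k)) \<longlonglongrightarrow> (d, \<rho>) \<and>
      (\<forall>k. (x k, r k) + t k *\<^sub>R (w' k, \<rho>' k) \<in> epi f)"
    by (intro exI[of _ "\<lambda>_. d"] exI[of _ "\<lambda>_. \<rho>"]) simp
qed

text \<open>The zero last component of the normal cancels \<open>\<rho>\<close>, so the singular
  subdifferential is the polar of the projection of the tangent cone to the first factor.\<close>

lemma singular_subdiff_inf_iff:
  "u \<in> singular_subdiff_inf f \<longleftrightarrow> (\<forall>w \<rho>. (w, \<rho>) \<in> tangent_inf_fst (epi f) \<longrightarrow> u \<bullet> w \<le> 0)"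
  by (auto simp: singular_subdiff_inf_def normal_inf_fst_def)

theorem proposition4p7:
  fixes f :: "real ^ 'n \<Rightarrow> ereal"
  assumes "\<And>x. f x \<noteq> -\<infinity>"
    and "proper f"
    and "lower_semicont f"
    and "econvex f"
    and "\<not> bounded (edom f)"
  shows "normal_inf (edom f) \<subseteq> singular_subdiff_inf f \<and>
    singular_subdiff_inf f \<subseteq> polar (edom (recession_fun f)) \<and>
    ((\<forall>w\<in>tangent_inf (edom f). \<exists>r::real. (w, r) \<in> tangent_inf_fst (epi f)) \<longrightarrow>
      normal_inf (edom f) = singular_subdiff_inf f)"
proof (intro conjI impI)
  \<comment> \<open>Polarity reverses the inclusion of the projected tangent cone in
    \<open>tangent_inf (edom f)\<close>.\<close>
  show incl: "normal_inf (edom f) \<subseteq> singular_subdiff_inf f"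
    using tangent_inf_fst_epi_imp_tangent_inf_edom[of f, OF assms(1)]
    by (auto simp: normal_inf_def singular_subdiff_inf_iff)
  show "singular_subdiff_inf f \<subseteq> polar (edom (recession_fun f))"
  proof
    fix u assume u: "u \<in> singular_subdiff_inf f"
    have "u \<bullet> d \<le> 0" if "d \<in> edom (recession_fun f)" for d
    proof -
      from that have "recession_fun f d < \<infinity>" by (simp add: edom_def)
      \<comment> \<open>A real strictly above the recession value supplies the strict slope bound,
        whether or not that value is itself known to be real.\<close>
      from ereal_dense2[OF this] obtain \<rho> where "recession_fun f d < ereal \<rho>" by blast
      then have "(d, \<rho>) \<in> tangent_inf_fst (epi f)"
        by (rule recession_fun_less_imp_tangent_inf_fst_epi[OF assms(1,3,4)])
      with u show ?thesis by (auto simp: singular_subdiff_inf_iff)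
    qed
    then show "u \<in> polar (edom (recession_fun f))" by (simp add: polar_def)
  qed
  \<comment> \<open>The condition makes the projection contain all of
    \<open>tangent_inf (edom f)\<close>, which gives the reverse inclusion of the polars.\<close>
  assume "\<forall>w\<in>tangent_inf (edom f). \<exists>r::real. (w, r) \<in> tangent_inf_fst (epi f)"
  then have "singular_subdiff_inf f \<subseteq> normal_inf (edom f)"
    by (fastforce simp: normal_inf_def singular_subdiff_inf_iff)
  with incl show "normal_inf (edom f) = singular_subdiff_inf f" by blast
qed

end
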